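(* If $X$ is any compact metric space of positive Hausdorff dimension, then $\mathscr{W}_2(X)$ has at least intermediate size, and more precisely \[\mathrm{crit}_{\mathscr{I}}\,\mathscr{W}_2(X)\geqslant 2,\qquad \mathrm{crit}_{\mathscr{I}_2}\,\mathscr{W}_2(X)\geqslant\frac{\dim X}{2\log 3},\] where $\dim X$ denotes the Hausdorff dimension of $X$.
   Context: For $f:[0,T)\to[0,+\infty)$ continuous non-decreasing with $f(0)=0$ and a subset $A$ of a Polish metric space, let $\Lambda_f(A)=\lim_{\delta\to0}\inf\big\{\sum_{i=1}^\infty f(\operatorname{diam}E_i): A\subset\bigcup_iE_i,\ \operatorname{diam}E_i\le\delta,\ E_i\text{ closed}\big\}$. For a family $\mathscr{F}=(f_s)_{s\in J}$ of such functions, with $J\subset\mathbb R$ an interval, the critical parameter is $\mathrm{crit}_{\mathscr F}A=\sup\{s\in J:\Lambda_{f_s}(A)>0\}=\inf\{s\in J:\Lambda_{f_s}(A)=0\}$ (with $\sup\emptyset=\inf J$, $\inf\emptyset=\sup J$), an element of the closure of $J$ in $[-\infty,+\infty]$; for a space, $A$ is the whole space. The coarse intermediate scale is $\mathscr{I}=\big(r\mapsto e^{-(\log\frac1r)^s}\big)_{s\in[1,+\infty)}$; the fine intermediate scale $\mathscr{I}_2$ is $\big(r\mapsto e^{-s(\log\frac1r)^2}\big)_{s\in(0,+\infty)}$ (functions of small $r>0$, with value $0$ at $0$). A space has at least intermediate size if its critical parameter in an intermediate scale is not the minimal value of the parameter range. For $X$ compact with metric $d$, $\mathscr{W}_2(X)$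 is the set of all Borel probability measures on $X$ with the metric $\mathrm{W}_2(\mu,\nu)=\big(\inf_\Pi\int_{X\times X}d(x,y)^2\,\Pi(dx\,dy)\big)^{1/2}$, the infimum being over probability measures $\Pi$ on $X\times X$ with marginals $\mu$ and $\nu$. *)

theory Defs
  imports "HOL-Probability.Probability"
begin

section \<open>Generalised Hausdorff measures and critical parameters\<close>

text \<open>
  Metric spaces are given by a carrier \<^term>\<open>M\<close> and a distance \<^term>\<open>d\<close>, as in the locale
  \<^locale>\<open>Metric_space\<close>, since a Wasserstein space is not a type.
\<close>

definition mdiam :: "('a \<Rightarrow> 'a \<Rightarrow> real) \<Rightarrow> 'a set \<Rightarrow> ennreal"
  where "mdiam d E = (SUP x\<in>E. SUP y\<in>E. ennreal (d x y))"

text \<open>Finite covers are included: pad with empty sets, of diameter 0.\<close>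

definition closed_covers ::
    "'a set \<Rightarrow> ('a \<Rightarrow> 'a \<Rightarrow> real) \<Rightarrow> 'a set \<Rightarrow> real \<Rightarrow> (nat \<Rightarrow> 'a set) set"
  where "closed_covers M d A \<delta> =
    {E. A \<subseteq> (\<Union>i. E i) \<and>
        (\<forall>i. E i \<subseteq> M \<and> closedin (Metric_space.mtopology M d) (E i) \<and> mdiam d (E i) \<le> ennreal \<delta>)}"

text \<open>
  A gauge function \<open>f : [0,T) \<rightarrow> [0,\<infinity>)\<close> is represented by a total function; its values
  outside \<open>[0,T)\<close> play no role because \<open>\<delta>\<close> tends to 0.
\<close>

definition gen_hausdorff_measure ::
    "(real \<Rightarrow> real) \<Rightarrow> 'a set \<Rightarrow> ('a \<Rightarrow> 'a \<Rightarrow> real) \<Rightarrow> 'a set \<Rightarrow> ennreal"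
  where "gen_hausdorff_measure f M d A =
    Lim (at_right 0)
      (\<lambda>\<delta>. INF E\<in>closed_covers M d A \<delta>. \<Sum>i. ennreal (f (enn2real (mdiam d (E i)))))"

text \<open>
  The critical parameter of the whole space. The supremum of the empty set is \<^term>\<open>Inf J\<close>, not
  \<open>-\<infinity>\<close>.
\<close>

definition crit :: "real set \<Rightarrow> (real \<Rightarrow> real \<Rightarrow> real) \<Rightarrow> 'a set \<Rightarrow> ('a \<Rightarrow> 'a \<Rightarrow> real) \<Rightarrow> ereal"
  where "crit J F M d =
    (let S = {s\<in>J. gen_hausdorff_measure (F s) M d M > 0}
     in if S = {} then Inf (ereal ` J) else Sup (ereal ` S))"

text \<open>
  Hausdorff dimension is the critical parameter of the gauges \<open>r \<mapsto> r\<^sup>s\<close>; covering by closed sets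
  rather than arbitrary ones gives the same measure, as closure preserves the diameter.
\<close>

definition hausdorff_dim :: "'a set \<Rightarrow> ('a \<Rightarrow> 'a \<Rightarrow> real) \<Rightarrow> ereal"
  where "hausdorff_dim M d = crit {0<..} (\<lambda>s r. r powr s) M d"

section \<open>Intermediate scales\<close>

text \<open>The formulas are meaningful for \<open>0 \<le> r < 1\<close>.\<close>

definition coarse_gauge :: "real \<Rightarrow> real \<Rightarrow> real"
  where "coarse_gauge s r = (if r = 0 then 0 else exp (- (ln (1 / r) powr s)))"

definition fine_gauge :: "real \<Rightarrow> real \<Rightarrow> real"
  where "fine_gauge s r = (if r = 0 then 0 else exp (- s * (ln (1 / r))\<^sup>2))"

definition crit_coarse :: "'a set \<Rightarrow> ('a \<Rightarrow> 'a \<Rightarrow> real) \<Rightarrow> ereal"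
  where "crit_coarse M d = crit {1..} coarse_gauge M d"

definition crit_fine :: "'a set \<Rightarrow> ('a \<Rightarrow> 'a \<Rightarrow> real) \<Rightarrow> ereal"
  where "crit_fine M d = crit {0<..} fine_gauge M d"

definition at_least_intermediate_size :: "'a set \<Rightarrow> ('a \<Rightarrow> 'a \<Rightarrow> real) \<Rightarrow> bool"
  where "at_least_intermediate_size M d \<longleftrightarrow>
    crit_coarse M d \<noteq> Inf (ereal ` {1..}) \<or> crit_fine M d \<noteq> Inf (ereal ` {0<..})"

section \<open>The quadratic Wasserstein space of a compact set\<close>

definition wasserstein_space :: "'a::metric_space set \<Rightarrow> 'a measure set"
  where "wasserstein_space X = {\<mu>. sets \<mu> = sets (restrict_space borel X) \<and> prob_space \<mu>}"

text \<open>
  For compact \<^term>\<open>X\<close> the product \<open>\<sigma>\<close>-algebra used here is the Borel \<open>\<sigma>\<close>-algebra of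
  \<^term>\<open>X \<times> X\<close>, because \<^term>\<open>X\<close> is second countable.
\<close>

definition couplings :: "'a measure \<Rightarrow> 'a measure \<Rightarrow> ('a \<times> 'a) measure set"
  where "couplings \<mu> \<nu> =
    {P. sets P = sets (\<mu> \<Otimes>\<^sub>M \<nu>) \<and> prob_space P \<and> distr P \<mu> fst = \<mu> \<and> distr P \<nu> snd = \<nu>}"

definition W2 :: "'a::metric_space measure \<Rightarrow> 'a measure \<Rightarrow> real"
  where "W2 \<mu> \<nu> =
    sqrt (enn2real (INF P\<in>couplings \<mu> \<nu>. \<integral>\<^sup>+ p. ennreal ((dist (fst p) (snd p))\<^sup>2) \<partial>P))"

end

theory Submission
  imports Defs
begin

text \<open>
  The lower bounds come from the measures \<open>\<mu> x\<close> with mass \<open>3 / 4^(i+1)\<close> at \<open>x i\<close>, where \<open>x\<close> ranges over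
  the sequences in \<open>X\<close>. Two different sums of the first \<open>n\<close> weights differ by more than the mass of all
  later ones, so that \<open>\<mu> x\<close> determines \<open>x\<close>; quantitatively, \<open>W2 (\<mu> x) (\<mu> y) < r\<close> in both orders forces
  \<open>dist (x n) (y n) \<le> 3^(n+2) r\<close> (\<open>W2_atomic_measure_dist_le\<close>, \<open>digit_loss_le\<close>). Hence the sequences
  whose measure lies in a set of diameter less than \<open>3^(-m-2)\<close> lie in a box whose \<open>i\<close>-th side, for
  \<open>i < m\<close>, has diameter at most \<open>3^(-(m-i))\<close>.

  If \<open>X\<close> has dimension larger than \<open>t\<close>, such a box should have size about \<open>3^(-t m (m+1) / 2)\<close>. As
  \<open>exp (-s (m ln 3)^2) = 3^(-s m^2 ln 3)\<close>, this is below the fine gauge with parameter \<open>s\<close> at \<open>3^(-m)\<close>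
  as soon as \<open>2 s ln 3 < t\<close>, up to factors exponential in \<open>m\<close>, which are of lower order. So a cover
  by sets of small diameter cannot have small total gauge.

  To turn this heuristic into a bound for covers one could take a Frostman measure on \<open>X\<close> and its
  infinite power. The proof below stays with covers instead, but admits weights: the cheapest
  weighted cover of \<open>X\<close> still has positive cost (\<open>weighted_cover_cost_bounded_below\<close>), and the cost of
  weighted covers is compatible with products, because one coordinate after the other can be chosen
  so as to keep the remaining cost below 1 (\<open>greedy_uncovered_sequence\<close>).

  For the coarse scale, the gauges with parameter \<open>s < 2\<close> exceed every fine gauge near 0.
\<close>

section \<open>Positivity of generalised Hausdorff measures\<close>

text \<open>
  The infimum increases as the mesh decreases, so the limit exists and is a supremum.
\<close>

lemma gen_hausdorff_measure_eq_SUP: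
  "gen_hausdorff_measure f M d A =
    (SUP \<delta>\<in>{0<..}. INF E\<in>closed_covers M d A \<delta>. \<Sum>i. ennreal (f (enn2real (mdiam d (E i)))))"
proof -
  define H where "H \<delta> = (INF E\<in>closed_covers M d A \<delta>. \<Sum>i. ennreal (f (enn2real (mdiam d (E i)))))"
    for \<delta>
  have "(H \<longlongrightarrow> (SUP \<delta>\<in>{0<..}. H \<delta>)) (at_right 0)"
  proof (rule order_tendstoI)
    fix a assume "a < (SUP \<delta>\<in>{0<..}. H \<delta>)"
    then obtain \<delta> where \<delta>: "\<delta> > 0" "a < H \<delta>"
      by (auto simp: less_SUP_iff)
    have "H \<delta> \<le> H \<delta>'" if "\<delta>' < \<delta>" for \<delta>'
      unfolding H_def
    proof (rule INF_superset_mono)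
      show "closed_covers M d A \<delta>' \<subseteq> closed_covers M d A \<delta>"
        using that unfolding closed_covers_def
        by (auto intro: order_trans[OF _ ennreal_leI])
    qed simp
    then show "\<forall>\<^sub>F \<delta> in at_right 0. a < H \<delta>"
      unfolding eventually_at_right_field using \<delta> by (meson less_le_trans)
  next
    fix a assume "(SUP \<delta>\<in>{0<..}. H \<delta>) < a"
    then show "\<forall>\<^sub>F \<delta> in at_right 0. H \<delta> < a"
      unfolding eventually_at_right_field
      by (metis SUP_upper greaterThan_iff le_less_trans zero_less_one)
  qed
  then show ?thesis
    unfolding gen_hausdorff_measure_def H_def[symmetric]
    by (intro tendsto_Lim) simp_all
qed

text \<open>
  Positivity is thus a uniform lower bound for the covers of a single mesh size, which is the form
  used throughout.
\<close>

lemma gen_hausdorff_measure_pos_iff: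
  "gen_hausdorff_measure f M d A > 0 \<longleftrightarrow>
    (\<exists>\<delta>>0. \<exists>\<kappa>::real. \<kappa> > 0 \<and>
      (\<forall>E\<in>closed_covers M d A \<delta>. ennreal \<kappa> \<le> (\<Sum>i. ennreal (f (enn2real (mdiam d (E i)))))))"
proof -
  have "(0 < (c::ennreal)) \<longleftrightarrow> (\<exists>\<kappa>::real. \<kappa> > 0 \<and> ennreal \<kappa> \<le> c)" for c
  proof
    assume "0 < c"
    then obtain b where "0 < b" "b < c"
      using dense by blast
    then show "\<exists>\<kappa>::real. \<kappa> > 0 \<and> ennreal \<kappa> \<le> c"
      by (cases b) auto
  next
    show "\<exists>\<kappa>::real. \<kappa> > 0 \<and> ennreal \<kappa> \<le> c \<Longrightarrow> 0 < c"
      by (meson ennreal_less_zero_iff less_le_trans)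
  qed
  then show ?thesis
    unfolding gen_hausdorff_measure_eq_SUP less_SUP_iff by (simp add: le_INF_iff Bex_def)
qed

lemma gen_hausdorff_measure_pos_mono:
  assumes pos: "gen_hausdorff_measure g M d A > 0"
    and "\<rho> > 0" and le: "\<And>r. 0 \<le> r \<Longrightarrow> r \<le> \<rho> \<Longrightarrow> g r \<le> f r"
  shows "gen_hausdorff_measure f M d A > 0"
proof -
  from pos obtain \<delta> \<kappa> where *: "\<delta> > 0" "\<kappa> > (0::real)"
      "\<And>E. E \<in> closed_covers M d A \<delta> \<Longrightarrow> ennreal \<kappa> \<le> (\<Sum>i. ennreal (g (enn2real (mdiam d (E i)))))"
    unfolding gen_hausdorff_measure_pos_iff by blast
  have "ennreal \<kappa> \<le> (\<Sum>i. ennreal (f (enn2real (mdiam d (E i)))))"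
    if E: "E \<in> closed_covers M d A (min \<delta> \<rho>)" for E
  proof -
    have diam: "mdiam d (E i) \<le> ennreal (min \<delta> \<rho>)" for i
      using E by (auto simp: closed_covers_def)
    then have "E \<in> closed_covers M d A \<delta>"
      using E unfolding closed_covers_def
      by (auto intro: order_trans[OF diam ennreal_leI])
    moreover have "enn2real (mdiam d (E i)) \<le> \<rho>" for i
      using diam[of i] \<open>\<delta> > 0\<close> \<open>\<rho> > 0\<close>
      by (metis enn2real_leI less_eq_real_def min_less_iff_conj order_trans min.cobounded2)
    ultimately have "ennreal (g (enn2real (mdiam d (E i)))) \<le> ennreal (f (enn2real (mdiam d (E i))))" for i
      by (intro ennreal_leI le) auto
    then have "(\<Sum>i. ennreal (g (enn2real (mdiam d (E i))))) \<le> (\<Sum>i. ennreal (f (enn2real (mdiam d (E i)))))"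
      by (intro suminf_le) auto
    with *(3)[OF \<open>E \<in> closed_covers M d A \<delta>\<close>] show ?thesis
      by (rule order_trans)
  qed
  then show ?thesis
    unfolding gen_hausdorff_measure_pos_iff using *(1,2) \<open>\<rho> > 0\<close>
    by (intro exI[of _ "min \<delta> \<rho>"]) auto
qed

lemma mdiam_le_iff:
  assumes "0 \<le> r"
  shows "mdiam d E \<le> ennreal r \<longleftrightarrow> (\<forall>x\<in>E. \<forall>y\<in>E. d x y \<le> r)"
  using assms unfolding mdiam_def SUP_le_iff by (simp add: ennreal_le_iff)

section \<open>Weighted covers of a set of positive Hausdorff measure\<close>

lemma suminf_ennreal_swap:
  fixes f :: "nat \<Rightarrow> nat \<Rightarrow> ennreal"
  shows "(\<Sum>i. \<Sum>j. f i j) = (\<Sum>j. \<Sum>i. f i j)"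
proof -
  have "(\<Sum>i. \<Sum>j. f i j) = (\<integral>\<^sup>+ i. (\<Sum>j. f i j) \<partial>count_space UNIV)"
    by (simp add: nn_integral_count_space_nat)
  also have "\<dots> = (\<Sum>j. \<integral>\<^sup>+ i. f i j \<partial>count_space UNIV)"
    by (rule nn_integral_suminf) simp
  finally show ?thesis
    by (simp add: nn_integral_count_space_nat)
qed

lemma suminf_ennreal_split:
  fixes f :: "nat \<Rightarrow> ennreal" and k :: "nat \<Rightarrow> nat"
  shows "(\<Sum>i. \<Sum>j. if k j = i then f j else 0) = (\<Sum>j. f j)"
proof -
  have "(\<Sum>i. if k j = i then f j else 0) = f j" for j
    by (subst suminf_finite[of "{k j}"]) auto
  then show ?thesis
    by (subst suminf_ennreal_swap) simp
qed

text \<open>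
  A separated set of maximal cardinality cannot be enlarged, and is therefore a net.
\<close>

lemma separated_net_exists:
  fixes Y :: "'a::metric_space set" and \<epsilon> :: real
  assumes bound: "\<And>F. \<lbrakk>F \<subseteq> Y; finite F; \<forall>x\<in>F. \<forall>y\<in>F. x \<noteq> y \<longrightarrow> \<epsilon> < dist x y\<rbrakk> \<Longrightarrow> card F \<le> N"
    and "0 \<le> \<epsilon>"
  shows "\<exists>F. F \<subseteq> Y \<and> finite F \<and> (\<forall>x\<in>F. \<forall>y\<in>F. x \<noteq> y \<longrightarrow> \<epsilon> < dist x y) \<and>
    Y \<subseteq> (\<Union>z\<in>F. cball z \<epsilon>)"
proof -
  define P where "P F \<longleftrightarrow> F \<subseteq> Y \<and> finite F \<and> (\<forall>x\<in>F. \<forall>y\<in>F. x \<noteq> y \<longrightarrow> \<epsilon> < dist x y)" for F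
  have "\<forall>F. P F \<longrightarrow> card F < Suc N"
    using bound by (auto simp: P_def less_Suc_eq_le)
  moreover have "P {}"
    by (simp add: P_def)
  ultimately obtain F where F: "P F" and max: "\<And>G. P G \<Longrightarrow> card G \<le> card F"
    using ex_has_greatest_nat[of P "{}" card "Suc N"] by blast
  have "y \<in> (\<Union>z\<in>F. cball z \<epsilon>)" if "y \<in> Y" for y
  proof (rule ccontr)
    assume "y \<notin> (\<Union>z\<in>F. cball z \<epsilon>)"
    then have far: "\<epsilon> < dist z y" if "z \<in> F" for z
      using that by (auto simp: not_le)
    then have "P (insert y F)"
      using F \<open>y \<in> Y\<close> by (auto simp: P_def dist_commute)
    moreover have "y \<notin> F"
      using far \<open>0 \<le> \<epsilon>\<close> by fastforce
    ultimately show False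
      using max[of "insert y F"] F by (simp add: P_def)
  qed
  with F show ?thesis
    unfolding P_def by blast
qed

text \<open>
  A doubly indexed family of balls, grouped by radius, is the shape in which covers arise from a
  decomposition of the space into scales.
\<close>

lemma ball_cover_cost_ge:
  fixes X :: "'a::metric_space set" and N :: "nat \<Rightarrow> nat" and h :: "nat \<Rightarrow> nat \<Rightarrow> 'a"
  assumes \<kappa>: "\<And>E. E \<in> closed_covers X dist X \<delta> \<Longrightarrow> \<kappa> \<le> (\<Sum>i. ennreal (enn2real (mdiam dist (E i)) powr s))"
    and "0 \<le> s"
    and r: "\<And>k. 0 \<le> r k" "\<And>k i. i < N k \<Longrightarrow> 2 * r k \<le> \<delta>" and "0 \<le> \<delta>"
    and h: "\<And>k i. i < N k \<Longrightarrow> h k i \<in> X"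
    and cover: "X \<subseteq> (\<Union>k. \<Union>i<N k. cball (h k i) (r k))"
  shows "\<kappa> \<le> (\<Sum>k. of_nat (N k) * ennreal ((2 * r k) powr s))"
proof -
  interpret Metric_space X dist
    by unfold_locales (auto simp: dist_commute dist_triangle)
  define B where "B = (\<lambda>(k, i). if i < N k then mcball (h k i) (r k) else {})"
  have diam: "mdiam dist (B (k, i)) \<le> ennreal (if i < N k then 2 * r k else 0)" for k i
  proof -
    have "dist x y \<le> 2 * r k" if "dist (h k i) x \<le> r k" "dist (h k i) y \<le> r k" for x y
      using that dist_triangle2[of x y "h k i"] by (simp add: dist_commute)
    then show ?thesis
      using r(1)[of k] by (subst mdiam_le_iff) (auto simp: B_def)
  qed
  have "(\<lambda>n. B (prod_decode n)) \<in> closed_covers X dist X \<delta>"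
    unfolding closed_covers_def
  proof (intro CollectI conjI allI)
    show "X \<subseteq> (\<Union>n. B (prod_decode n))"
    proof
      fix x assume "x \<in> X"
      then obtain k i where "i < N k" "x \<in> cball (h k i) (r k)"
        using cover by blast
      then have "x \<in> B (prod_decode (prod_encode (k, i)))"
        using \<open>x \<in> X\<close> h by (simp add: B_def)
      then show "x \<in> (\<Union>n. B (prod_decode n))" by blast
    qed
  next
    fix n
    obtain k i where [simp]: "prod_decode n = (k, i)" by fastforce
    show "B (prod_decode n) \<subseteq> X"
      by (auto simp: B_def)
    show "closedin mtopology (B (prod_decode n))"
      by (simp add: B_def)
    show "mdiam dist (B (prod_decode n)) \<le> ennreal \<delta>"
      using diam[of k i] r(2)[of i k] \<open>0 \<le> \<delta>\<close> by (auto intro: order_trans ennreal_leI split: if_splits)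
  qed
  then have "\<kappa> \<le> (\<Sum>n. ennreal (enn2real (mdiam dist (B (prod_decode n))) powr s))"
    by (rule \<kappa>)
  also have "\<dots> = (\<Sum>k. \<Sum>i. ennreal (enn2real (mdiam dist (B (k, i))) powr s))"
    by (rule suminf_ennreal_2dimen[where f = "\<lambda>p. ennreal (enn2real (mdiam dist (B p)) powr s)"]) simp
  also have "\<dots> \<le> (\<Sum>k. of_nat (N k) * ennreal ((2 * r k) powr s))"
  proof (intro suminf_le)
    fix k
    have "(\<Sum>i. ennreal (enn2real (mdiam dist (B (k, i))) powr s))
        = (\<Sum>i<N k. ennreal (enn2real (mdiam dist (B (k, i))) powr s))"
      by (rule suminf_finite) (auto simp: B_def mdiam_def bot_ennreal)
    also have "\<dots> \<le> (\<Sum>i<N k. ennreal ((2 * r k) powr s))"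
    proof (intro sum_mono ennreal_leI powr_mono2)
      fix i assume "i \<in> {..<N k}"
      then show "enn2real (mdiam dist (B (k, i))) \<le> 2 * r k"
        using diam[of k i] r(1)[of k] by (intro enn2real_leI) simp_all
    qed (use \<open>0 \<le> s\<close> in auto)
    finally show "(\<Sum>i. ennreal (enn2real (mdiam dist (B (k, i))) powr s))
        \<le> of_nat (N k) * ennreal ((2 * r k) powr s)"
      by simp
  qed simp_all
  finally show ?thesis .
qed

text \<open>
  Double counting: a set of diameter at most \<open>\<epsilon>\<close> contains at most one point
  of \<open>F\<close>, so each weight is counted at most once.
\<close>

lemma separated_card_le_weights:
  fixes F :: "'a::metric_space set" and c :: "nat \<Rightarrow> ennreal" and A :: "nat \<Rightarrow> 'a set"
  assumes "finite F" and sep: "\<forall>x\<in>F. \<forall>y\<in>F. x \<noteq> y \<longrightarrow> \<epsilon> < dist x y"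
    and diam: "\<And>j x y. \<lbrakk>c j \<noteq> 0; x \<in> A j; y \<in> A j\<rbrakk> \<Longrightarrow> dist x y \<le> \<epsilon>"
    and p: "\<And>x. x \<in> F \<Longrightarrow> p \<le> (\<Sum>j. c j * indicator (A j) x)"
  shows "of_nat (card F) * p \<le> (\<Sum>j. c j)"
proof -
  have "of_nat (card F) * p \<le> (\<Sum>x\<in>F. \<Sum>j. c j * indicator (A j) x)"
    using sum_mono[of F "\<lambda>_. p", OF p] by simp
  also have "\<dots> = (\<Sum>j. \<Sum>x\<in>F. c j * indicator (A j) x)"
    by (rule suminf_sum[symmetric]) simp
  also have "\<dots> \<le> (\<Sum>j. c j)"
  proof (intro suminf_le)
    fix j
    show "(\<Sum>x\<in>F. c j * indicator (A j) x) \<le> c j"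
    proof (cases "c j = 0 \<or> F \<inter> A j = {}")
      case True
      then have "(\<Sum>x\<in>F. c j * indicator (A j) x) = 0"
        by (intro sum.neutral) (auto simp: indicator_def)
      then show ?thesis by simp
    next
      case False
      then obtain x where x: "x \<in> F" "x \<in> A j" and "c j \<noteq> 0" by blast
      have "y \<notin> A j" if "y \<in> F - {x}" for y
        using that sep diam[of j x y] x \<open>c j \<noteq> 0\<close> by fastforce
      then have "(\<Sum>y\<in>F - {x}. c j * indicator (A j) y) = 0"
        by (intro sum.neutral) auto
      then show ?thesis
        using sum.remove[OF \<open>finite F\<close> x(1), of "\<lambda>y. c j * indicator (A j) y"] x by simp
    qed
  qed simp_all
  finally show ?thesis .
qed

text \<open>
  The points where weighted sets of small diameter pile up to at least \<open>p\<close> can be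
  covered by few balls, their number being controlled by the total weight.
\<close>

lemma heavy_points_net:
  fixes X :: "'a::metric_space set" and c :: "nat \<Rightarrow> ennreal" and A :: "nat \<Rightarrow> 'a set"
  assumes diam: "\<And>j x y. \<lbrakk>c j \<noteq> 0; x \<in> A j; y \<in> A j\<rbrakk> \<Longrightarrow> dist x y \<le> \<epsilon>"
    and fin: "(\<Sum>j. c j) \<noteq> \<top>" and p: "0 < p" and "0 \<le> \<epsilon>"
  obtains F where "F \<subseteq> {x \<in> X. ennreal p \<le> (\<Sum>j. c j * indicator (A j) x)}" "finite F"
    "{x \<in> X. ennreal p \<le> (\<Sum>j. c j * indicator (A j) x)} \<subseteq> (\<Union>z\<in>F. cball z \<epsilon>)"
    "ennreal (real (card F) * p) \<le> (\<Sum>j. c j)"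
proof -
  define Y where "Y = {x \<in> X. ennreal p \<le> (\<Sum>j. c j * indicator (A j) x)}"
  have card: "ennreal (real (card F) * p) \<le> (\<Sum>j. c j)"
    if F: "F \<subseteq> Y" "finite F" "\<forall>x\<in>F. \<forall>y\<in>F. x \<noteq> y \<longrightarrow> \<epsilon> < dist x y" for F
  proof -
    have "ennreal p \<le> (\<Sum>j. c j * indicator (A j) x)" if "x \<in> F" for x
      using F(1) that unfolding Y_def by blast
    with F(2,3) diam have "of_nat (card F) * ennreal p \<le> (\<Sum>j. c j)"
      by (rule separated_card_le_weights)
    then show ?thesis
      using p by (simp add: ennreal_of_nat_eq_real_of_nat ennreal_mult)
  qed
  obtain \<sigma> where \<sigma>: "(\<Sum>j. c j) = ennreal \<sigma>" "0 \<le> \<sigma>"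
    using fin by (cases "\<Sum>j. c j") auto
  have bound: "card F \<le> nat \<lfloor>\<sigma> / p\<rfloor>"
    if "F \<subseteq> Y" "finite F" "\<forall>x\<in>F. \<forall>y\<in>F. x \<noteq> y \<longrightarrow> \<epsilon> < dist x y" for F
  proof -
    have "real (card F) * p \<le> \<sigma>"
      using card[OF that] \<sigma> by (simp add: ennreal_le_iff)
    then show ?thesis
      using p by (simp add: le_nat_floor pos_le_divide_eq)
  qed
  obtain F where F: "F \<subseteq> Y" "finite F" "\<forall>x\<in>F. \<forall>y\<in>F. x \<noteq> y \<longrightarrow> \<epsilon> < dist x y"
      "Y \<subseteq> (\<Union>z\<in>F. cball z \<epsilon>)"
    using separated_net_exists[of Y \<epsilon>, OF bound \<open>0 \<le> \<epsilon>\<close>] by blast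
  have "ennreal (real (card F) * p) \<le> (\<Sum>j. c j)"
    by (rule card[OF F(1-3)])
  with F(1,2,4) show thesis
    unfolding Y_def by (rule that)
qed

text \<open>
  A fractional analogue of Hausdorff content, with diameters rounded up to powers of
  \<open>1/3\<close> and \<open>b\<close> in the role of \<open>3 powr -t\<close>. Only the sets
  of nonzero weight are constrained, so that members of a family can be switched off.
\<close>

definition weighted_cover_cost_ge :: "'a::metric_space set \<Rightarrow> real \<Rightarrow> real \<Rightarrow> bool"
  where "weighted_cover_cost_ge X b w \<longleftrightarrow>
    (\<forall>(A::nat \<Rightarrow> 'a set) (c::nat \<Rightarrow> ennreal) (k::nat \<Rightarrow> nat).
      (\<forall>j. c j \<noteq> 0 \<longrightarrow> (\<forall>x\<in>A j. \<forall>y\<in>A j. dist x y \<le> 1 / 3 ^ k j)) \<longrightarrow>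
      (\<forall>x\<in>X. 1 \<le> (\<Sum>j. c j * indicator (A j) x)) \<longrightarrow>
      ennreal w \<le> (\<Sum>j. c j * ennreal b ^ k j))"

text \<open>
  A weighted cover splits according to the scale \<open>3^(-n)\<close> of its sets. If \<open>p n\<close> are positive numbers of
  sum less than 1, every point receives total weight at least \<open>p n\<close> from some scale \<open>n\<close>, and the points
  that do so for a given \<open>n\<close> are covered by at most \<open>S n / p n\<close> balls of radius \<open>3^(-n)\<close>, with \<open>S n\<close> the
  total weight at that scale. The gap between \<open>t\<close> and \<open>s\<close> pays for a geometric sequence \<open>p\<close>: the cost
  of these balls with exponent \<open>s\<close> is comparable to the cost of the weighted cover with exponent \<open>t\<close>.
\<close>

lemma weighted_cover_cost_bounded_below:
  fixes X :: "'a::metric_space set"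
  assumes pos: "gen_hausdorff_measure (\<lambda>r. r powr s) X dist X > 0" and "0 < t" "t < s"
  shows "\<exists>w>0. weighted_cover_cost_ge X (3 powr - t) w"
proof -
  from pos obtain \<delta> \<kappa> where "\<delta> > 0" "\<kappa> > (0::real)" and \<kappa>:
      "\<And>E. E \<in> closed_covers X dist X \<delta> \<Longrightarrow> ennreal \<kappa> \<le> (\<Sum>i. ennreal (enn2real (mdiam dist (E i)) powr s))"
    unfolding gen_hausdorff_measure_pos_iff by blast
  define q b :: real where "q = 3 powr - (s - t)" and "b = 3 powr - t"
  have q: "0 < q" "q < 1" and b: "0 < b"
    using \<open>t < s\<close> by (auto simp: q_def b_def powr_less_one)
  have qb: "q * b = 3 powr - s"
    by (simp add: q_def b_def flip: powr_add)
  have "(\<lambda>n. (1/3::real) ^ n) \<longlonglongrightarrow> 0"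
    by (intro LIMSEQ_realpow_zero) auto
  then have "\<forall>\<^sub>F n in sequentially. (1/3::real) ^ n < \<delta> / 2"
    using \<open>\<delta> > 0\<close> by (intro order_tendstoD) auto
  then obtain K where K: "\<And>k. k \<ge> K \<Longrightarrow> (1/3::real) ^ k < \<delta> / 2"
    unfolding eventually_sequentially by blast
  define p :: "nat \<Rightarrow> real" where "p k = (1 - q) / 2 * q ^ k" for k
  have p: "p k > 0" for k
    using q by (simp add: p_def)
  \<comment> \<open>The first bound excludes balls of radius above the mesh size, the second contradicts the bound \<open>\<kappa>\<close>.\<close>
  define w where "w = (1 - q) / 2 * min ((q * b) ^ K) (\<kappa> / 2 powr s) / 2"
  have w: "0 < w" "w < (1 - q) / 2 * (q * b) ^ K" "2 powr s * (2 * w / (1 - q)) < \<kappa>"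
  proof -
    define m where "m = min ((q * b) ^ K) (\<kappa> / 2 powr s)"
    have m: "0 < m" "m \<le> (q * b) ^ K" "m \<le> \<kappa> / 2 powr s"
      using q b \<open>\<kappa> > 0\<close> by (auto simp: m_def)
    have weq: "w = (1 - q) / 2 * (m / 2)"
      by (simp add: w_def m_def)
    show "0 < w"
      unfolding weq using q m by simp
    show "w < (1 - q) / 2 * (q * b) ^ K"
      unfolding weq using q m by (intro mult_strict_left_mono) auto
    have "2 powr s * (2 * w / (1 - q)) = 2 powr s * m / 2"
      using q by (simp add: weq field_simps)
    also have "\<dots> \<le> 2 powr s * (\<kappa> / 2 powr s) / 2"
      using m(3) by (intro divide_right_mono mult_left_mono) auto
    also have "\<dots> < \<kappa>"
      using \<open>\<kappa> > 0\<close> by simp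
    finally show "2 powr s * (2 * w / (1 - q)) < \<kappa>" .
  qed
  have "weighted_cover_cost_ge X (3 powr - t) w"
    unfolding weighted_cover_cost_ge_def
  proof (intro allI impI, rule ccontr)
    fix A :: "nat \<Rightarrow> 'a set" and c :: "nat \<Rightarrow> ennreal" and k :: "nat \<Rightarrow> nat"
    assume diam: "\<forall>j. c j \<noteq> 0 \<longrightarrow> (\<forall>x\<in>A j. \<forall>y\<in>A j. dist x y \<le> 1 / 3 ^ k j)"
      and cov: "\<forall>x\<in>X. 1 \<le> (\<Sum>j. c j * indicator (A j) x)"
      and "\<not> ennreal w \<le> (\<Sum>j. c j * ennreal (3 powr - t) ^ k j)"
    then have small: "(\<Sum>j. c j * ennreal b ^ k j) < ennreal w"
      by (simp add: b_def not_le)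
    define ck where "ck n j = (if k j = n then c j else 0)" for n j
    define S where "S n = (\<Sum>j. ck n j)" for n
    have S: "(\<Sum>n. S n * ennreal b ^ n) < ennreal w"
    proof -
      have "(\<Sum>n. S n * ennreal b ^ n) = (\<Sum>n. \<Sum>j. if k j = n then c j * ennreal b ^ k j else 0)"
        unfolding S_def ck_def ennreal_suminf_multc[symmetric]
        by (intro suminf_cong) auto
      also have "\<dots> < ennreal w"
        using small by (simp add: suminf_ennreal_split)
      finally show ?thesis .
    qed
    define Y where "Y n = {x \<in> X. ennreal (p n) \<le> (\<Sum>j. ck n j * indicator (A j) x)}" for n
    have XY: "X \<subseteq> (\<Union>n. Y n)"
    proof (rule ccontr)
      assume "\<not> X \<subseteq> (\<Union>n. Y n)"
      then obtain x where "x \<in> X" and "\<And>n. x \<notin> Y n"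
        by blast
      then have x: "(\<Sum>j. ck n j * indicator (A j) x) < ennreal (p n)" for n
        by (auto simp: Y_def not_le)
      have "1 \<le> (\<Sum>j. c j * indicator (A j) x)"
        using cov \<open>x \<in> X\<close> by blast
      also have "\<dots> = (\<Sum>n. \<Sum>j. if k j = n then c j * indicator (A j) x else 0)"
        by (rule suminf_ennreal_split[of k "\<lambda>j. c j * indicator (A j) x", symmetric])
      also have "\<dots> = (\<Sum>n. \<Sum>j. ck n j * indicator (A j) x)"
        by (intro arg_cong[where f = suminf] ext) (simp add: ck_def)
      also have "\<dots> \<le> (\<Sum>n. ennreal (p n))"
        by (intro suminf_le less_imp_le[OF x]) simp_all
      also have "\<dots> = ennreal (1 / 2)"
      proof (rule suminf_ennreal_eq)
        have "(\<lambda>k. (1 - q) / 2 * q ^ k) sums ((1 - q) / 2 * (1 / (1 - q)))"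
          using q by (intro sums_mult geometric_sums) simp
        moreover have "(1 - q) / 2 * (1 / (1 - q)) = 1 / 2"
          using q by simp
        ultimately show "p sums (1 / 2)"
          by (simp only: p_def[abs_def])
      qed (rule less_imp_le[OF p])
      also have "\<dots> < 1"
        using ennreal_lessI[of 1 "1 / 2"] by simp
      finally have "(1::ennreal) < 1" .
      then show False
        by simp
    qed
    have Sn: "S n \<noteq> \<top>" for n
    proof
      assume "S n = \<top>"
      then have "S n * ennreal b ^ n = \<top>"
        using b by (simp add: ennreal_power ennreal_top_mult)
      then show False
        using ennreal_suminf_lessD[OF S, of n] by simp
    qed
    have net: "\<exists>F. F \<subseteq> Y n \<and> finite F \<and> Y n \<subseteq> (\<Union>z\<in>F. cball z ((1/3) ^ n)) \<and>
        ennreal (real (card F) * p n) \<le> S n" for n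
    proof -
      have d: "dist x y \<le> (1/3) ^ n" if "ck n j \<noteq> 0" "x \<in> A j" "y \<in> A j" for j x y
        using that diam by (auto simp: ck_def power_one_over split: if_splits)
      show ?thesis
        using heavy_points_net[of "ck n" A "(1/3) ^ n" "p n" X, OF d _ p] Sn[of n]
        unfolding S_def Y_def by fastforce
    qed
    then obtain F where F: "\<And>n. F n \<subseteq> Y n" "\<And>n. finite (F n)"
        "\<And>n. Y n \<subseteq> (\<Union>z\<in>F n. cball z ((1/3) ^ n))"
        "\<And>n. ennreal (real (card (F n)) * p n) \<le> S n"
      by metis
    have cost: "ennreal (real (card (F n)) * (p n * b ^ n)) \<le> S n * ennreal b ^ n" for n
    proof -
      have "ennreal (real (card (F n)) * (p n * b ^ n))
          = ennreal (real (card (F n)) * p n) * ennreal b ^ n"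
        using p[of n] b by (simp add: ennreal_mult ennreal_power mult_ac)
      then show ?thesis
        using mult_right_mono[OF F(4), of "ennreal b ^ n" n] by simp
    qed
    \<comment> \<open>A single ball of radius \<open>3^(-n)\<close> with \<open>n < K\<close> would already cost more than \<open>w\<close>.\<close>
    have empty: "F n = {}" if "n < K" for n
    proof (rule ccontr)
      assume "F n \<noteq> {}"
      then have "1 \<le> real (card (F n))"
        using F(2)[of n] by (simp add: Suc_leI card_gt_0_iff)
      then have "p n * b ^ n \<le> real (card (F n)) * (p n * b ^ n)"
        using p[of n] b by simp
      also have "real (card (F n)) * (p n * b ^ n) < w"
      proof -
        have "0 \<le> real (card (F n)) * (p n * b ^ n)"
          using p[of n] b by simp
        moreover have "ennreal (real (card (F n)) * (p n * b ^ n)) < ennreal w"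
          using cost ennreal_suminf_lessD[OF S, of n] by (rule le_less_trans)
        ultimately show ?thesis
          by (simp only: ennreal_less_iff)
      qed
      finally have "p n * b ^ n < w" .
      moreover have "(1 - q) / 2 * (q * b) ^ K \<le> (1 - q) / 2 * (q * b) ^ n"
        using q b \<open>n < K\<close> \<open>0 < t\<close> \<open>t < s\<close>
        by (intro mult_left_mono power_decreasing) (auto simp: qb powr_less_one intro!: less_imp_le)
      ultimately show False
        using w(2) by (simp add: p_def power_mult_distrib mult.assoc)
    qed
    have "\<exists>h. bij_betw h {0..<card (F n)} (F n)" for n
      using F(2) by (rule ex_bij_betw_nat_finite)
    then obtain h where h: "\<And>n. bij_betw (h n) {0..<card (F n)} (F n)"
      by metis
    have h_im: "h n ` {..<card (F n)} = F n" for n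
      using h[of n] by (simp add: bij_betw_def lessThan_atLeast0)
    have "ennreal \<kappa> \<le> (\<Sum>n. of_nat (card (F n)) * ennreal ((2 * (1/3) ^ n) powr s))"
    proof (rule ball_cover_cost_ge[OF \<kappa>])
      show "0 \<le> s" "0 \<le> \<delta>"
        using \<open>0 < t\<close> \<open>t < s\<close> \<open>0 < \<delta>\<close> by auto
      show "2 * (1/3) ^ n \<le> \<delta>" if "i < card (F n)" for n i
        using that empty[of n] K[of n] by (cases "n < K") auto
      show "h n i \<in> X" if "i < card (F n)" for n i
        using that h_im[of n] F(1)[of n] by (auto simp: Y_def)
      show "X \<subseteq> (\<Union>n. \<Union>i<card (F n). cball (h n i) ((1/3) ^ n))"
      proof
        fix x assume "x \<in> X"
        then obtain n z where "z \<in> F n" "x \<in> cball z ((1/3) ^ n)"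
          using XY F(3) by blast
        moreover then obtain i where "i < card (F n)" "z = h n i"
          using h_im[of n] by blast
        ultimately show "x \<in> (\<Union>n. \<Union>i<card (F n). cball (h n i) ((1/3) ^ n))"
          by blast
      qed
    qed simp_all
    also have "\<dots> \<le> (\<Sum>n. ennreal (2 powr s * (2 / (1 - q))) * (S n * ennreal b ^ n))"
    proof (intro suminf_le)
      fix n
      have "((1/3::real) ^ n) powr s = ((1/3) powr s) ^ n"
      proof -
        have "((1/3::real) ^ n) powr s = ((1/3) powr real n) powr s"
          by (subst powr_realpow) simp_all
        also have "\<dots> = ((1/3) powr s) powr real n"
          by (simp only: powr_powr mult.commute)
        also have "\<dots> = ((1/3) powr s) ^ n"
          by (subst powr_realpow) simp_all
        finally show ?thesis .
      qed
      also have "(1/3) powr s = q * b"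
        unfolding qb by (simp add: powr_minus_divide powr_divide)
      finally have pn: "((1/3::real) ^ n) powr s = (q * b) ^ n" .
      have "(2 * (1/3) ^ n) powr s = 2 powr s * (2 / (1 - q)) * (p n * b ^ n)"
        using q by (simp add: powr_mult p_def power_mult_distrib pn)
      then have "of_nat (card (F n)) * ennreal ((2 * (1/3) ^ n) powr s)
          = ennreal (2 powr s * (2 / (1 - q))) * ennreal (real (card (F n)) * (p n * b ^ n))"
        using q b p[of n]
        by (simp add: ennreal_of_nat_eq_real_of_nat ennreal_mult[symmetric] less_imp_le mult_ac)
      also have "\<dots> \<le> ennreal (2 powr s * (2 / (1 - q))) * (S n * ennreal b ^ n)"
        using cost by (rule mult_left_mono) simp
      finally show "of_nat (card (F n)) * ennreal ((2 * (1/3) ^ n) powr s)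
          \<le> ennreal (2 powr s * (2 / (1 - q))) * (S n * ennreal b ^ n)" .
    qed simp_all
    also have "\<dots> \<le> ennreal (2 powr s * (2 / (1 - q))) * ennreal w"
      unfolding ennreal_suminf_cmult using S by (intro mult_left_mono) auto
    also have "\<dots> = ennreal (2 powr s * (2 * w / (1 - q)))"
      using q w(1) by (simp add: ennreal_mult[symmetric] mult_ac)
    also have "\<dots> < ennreal \<kappa>"
      using w(3) \<open>\<kappa> > 0\<close> by (simp only: ennreal_lessI)
    finally show False by simp
  qed
  with w(1) show ?thesis by blast
qed

section \<open>Covers of a sequence space by boxes\<close>

text \<open>
  Boxes are products over \<open>i < n j\<close> of sets of diameter at most \<open>3^(-(n j - i))\<close>. Once the first \<open>k\<close>
  coordinates are chosen, the boxes still compatible with them carry a cost that accounts for the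
  remaining sides only; a box whose sides are exhausted costs 1. If every choice of the next
  coordinate brought the total up to 1, the remaining costs would be the weights of a weighted cover
  of \<open>X\<close> by the \<open>k\<close>-th sides, and its lower bound \<open>w\<close> would push the total before the choice up to 1
  as well. So the total can be kept below 1 forever, and no box is ever exhausted.
\<close>

lemma greedy_uncovered_sequence:
  fixes X :: "'a::metric_space set" and n :: "nat \<Rightarrow> nat" and A :: "nat \<Rightarrow> nat \<Rightarrow> 'a set"
  assumes "0 < w" "0 < b" and w: "weighted_cover_cost_ge X b w"
    and diam: "\<And>j i x y. \<lbrakk>i < n j; x \<in> A j i; y \<in> A j i\<rbrakk> \<Longrightarrow> dist x y \<le> 1 / 3 ^ (n j - i)"
    and small: "(\<Sum>j. ennreal (\<Prod>i=1..n j. b ^ i / w)) < 1"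
  obtains x where "\<And>i. x i \<in> X" "\<And>j. \<exists>i<n j. x i \<notin> A j i"
proof -
  define D where "D m = ennreal (\<Prod>i=1..m. b ^ i / w)" for m
  have D0: "D 0 = 1"
    by (simp add: D_def)
  have DSuc: "D (Suc m) = D m * ennreal b ^ Suc m / ennreal w" for m
    using \<open>0 < w\<close> \<open>0 < b\<close>
    by (simp add: D_def ennreal_mult prod_nonneg divide_ennreal[symmetric] ennreal_power
        ennreal_times_divide del: power_Suc)
  define alive where "alive k x j \<longleftrightarrow> (\<forall>i<min k (n j). x i \<in> A j i)" for k x j
  define \<Phi> where "\<Phi> k x = (\<Sum>j. if alive k x j then D (n j - k) else 0)" for k x
  have step: "\<exists>a\<in>X. \<Phi> (Suc k) (x(k := a)) < 1" if "\<Phi> k x < 1" for k x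
  proof (rule ccontr)
    assume no: "\<not> (\<exists>a\<in>X. \<Phi> (Suc k) (x(k := a)) < 1)"
    define c where "c j = (if alive k x j \<and> k < n j then D (n j - Suc k) else 0)" for j
    \<comment> \<open>An exhausted box would contribute 1 on its own.\<close>
    have dead: "k < n j" if "alive k x j" for j
    proof (rule ccontr)
      assume "\<not> k < n j"
      then have "(if alive k x j then D (n j - k) else 0) = 1"
        using that by (simp add: D0)
      then show False
        using ennreal_suminf_lessD[OF \<open>\<Phi> k x < 1\<close>[unfolded \<Phi>_def], of j] by simp
    qed
    have "ennreal w \<le> (\<Sum>j. c j * ennreal b ^ (n j - k))"
    proof (rule w[unfolded weighted_cover_cost_ge_def, rule_format, of c "\<lambda>j. A j k"])
      show "dist x y \<le> 1 / 3 ^ (n j - k)" if "c j \<noteq> 0" "x \<in> A j k" "y \<in> A j k" for j x y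
        using that diam[of k j] by (auto simp: c_def split: if_splits)
    next
      fix a assume "a \<in> X"
      then have "1 \<le> \<Phi> (Suc k) (x(k := a))"
        using no by (auto simp: not_less)
      also have "\<dots> = (\<Sum>j. c j * indicator (A j k) a)"
        unfolding \<Phi>_def
      proof (intro arg_cong[where f = suminf] ext)
        fix j
        have "alive (Suc k) (x(k := a)) j \<longleftrightarrow> alive k x j \<and> a \<in> A j k"
          using dead[of j] unfolding alive_def by (auto simp: less_Suc_eq)
        then show "(if alive (Suc k) (x(k := a)) j then D (n j - Suc k) else 0)
            = c j * indicator (A j k) a"
          using dead[of j] by (simp add: c_def)
      qed
      finally show "1 \<le> (\<Sum>j. c j * indicator (A j k) a)" .
    qed
    then have "ennreal w / ennreal w \<le> (\<Sum>j. c j * ennreal b ^ (n j - k)) / ennreal w"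
      by (rule divide_right_mono_ennreal)
    also have "ennreal w / ennreal w = 1"
      using \<open>0 < w\<close> by simp
    also have "(\<Sum>j. c j * ennreal b ^ (n j - k)) / ennreal w = \<Phi> k x"
      unfolding \<Phi>_def ennreal_suminf_divide[symmetric]
    proof (intro arg_cong[where f = suminf] ext)
      fix j
      show "c j * ennreal b ^ (n j - k) / ennreal w = (if alive k x j then D (n j - k) else 0)"
      proof (cases "alive k x j")
        case True
        with dead have "n j - k = Suc (n j - Suc k)" by (simp add: Suc_diff_Suc)
        then have "D (n j - k) = D (n j - Suc k) * ennreal b ^ (n j - k) / ennreal w"
          using DSuc[of "n j - Suc k"] by simp
        then show ?thesis
          using True dead by (simp add: c_def)
      qed (simp add: c_def)
    qed
    finally show False
      using \<open>\<Phi> k x < 1\<close> by simp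
  qed
  define P where "P k x \<longleftrightarrow> \<Phi> k x < 1 \<and> (\<forall>i<k. x i \<in> X)" for k x
  have "\<exists>f. \<forall>k. P k (f k) \<and> (\<exists>a. f (Suc k) = (f k)(k := a))"
  proof (rule dependent_nat_choice)
    show "\<exists>x. P 0 x"
      using small by (simp add: P_def \<Phi>_def alive_def D_def)
  next
    fix x k assume "P k x"
    with step[of k x] obtain a where "a \<in> X" "\<Phi> (Suc k) (x(k := a)) < 1"
      by (auto simp: P_def)
    with \<open>P k x\<close> show "\<exists>y. P (Suc k) y \<and> (\<exists>a. y = x(k := a))"
      by (intro exI[of _ "x(k := a)"]) (auto simp: P_def less_Suc_eq)
  qed
  then obtain f where f: "\<And>k. P k (f k)" "\<And>k. \<exists>a. f (Suc k) = (f k)(k := a)"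
    by blast
  define x where "x i = f (Suc i) i" for i
  have agree: "f k i = x i" if "i < k" for i k
    using that
  proof (induction k)
    case (Suc k)
    then show ?case
      using f(2)[of k] by (cases "i = k") (auto simp: x_def)
  qed simp
  show thesis
  proof (rule that)
    show "x i \<in> X" for i
      using f(1)[of "Suc i"] by (simp add: x_def P_def)
    show "\<exists>i<n j. x i \<notin> A j i" for j
    proof (rule ccontr)
      assume "\<not> (\<exists>i<n j. x i \<notin> A j i)"
      then have "(if alive (n j) (f (n j)) j then D (n j - n j) else 0) = 1"
        using agree by (auto simp: alive_def D0)
      moreover have "\<Phi> (n j) (f (n j)) < 1"
        using f(1) by (simp add: P_def)
      ultimately show False
        using ennreal_suminf_lessD[of _ 1 j] unfolding \<Phi>_def by fastforce
    qed
  qed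
qed

section \<open>Wasserstein distance between measures with geometric weights\<close>

text \<open>
  The geometric distribution of parameter \<open>3/4\<close> gives mass \<open>3 / 4^(i+1)\<close>
  to \<open>i\<close>, so the sums of weights are the numbers whose base 4 expansion has digits 0
  and 3.
\<close>

definition atomic_measure :: "'a::metric_space set \<Rightarrow> (nat \<Rightarrow> 'a) \<Rightarrow> 'a measure"
  where "atomic_measure X x = distr (measure_pmf (geometric_pmf (3/4))) (restrict_space borel X) x"

abbreviation weight :: "nat set \<Rightarrow> real"
  where "weight I \<equiv> measure_pmf.prob (geometric_pmf (3/4)) I"

lemma weight_singleton: "weight {n} = 3 / 4 ^ Suc n"
  by (simp add: measure_pmf_single power_one_over divide_simps)

lemma weight_greaterThan: "weight {m<..} = 1 / 4 ^ Suc m"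
proof -
  have "weight {..m} = (\<Sum>i\<le>m. 3 / 4 ^ Suc i)"
    by (subst measure_measure_pmf_finite) (auto simp: power_one_over divide_simps intro!: sum.cong)
  also have "\<dots> = 1 - 1 / 4 ^ Suc m"
    by (induction m) (auto simp: field_simps)
  finally have "weight {..m} = 1 - 1 / 4 ^ Suc m" .
  moreover have "{m<..} = UNIV - {..m}"
    by auto
  ultimately show ?thesis
    using measure_pmf.prob_compl[of "{..m}" "geometric_pmf (3/4)"] by simp
qed

text \<open>
  The weights after position \<open>m\<close> sum to a third of the weight at \<open>m\<close>, so
  the first difference between two index sets decides and leaves a gap.
\<close>

lemma weight_diff_first_difference:
  assumes "m \<in> I" "m \<notin> J" and agree: "\<And>i. i < m \<Longrightarrow> i \<in> I \<longleftrightarrow> i \<in> J"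
  shows "weight J + 2 / 4 ^ Suc m \<le> weight I"
proof -
  have "weight J \<le> weight (I \<inter> {..<m} \<union> {m<..})"
    using assms(1,2) agree by (intro measure_pmf.finite_measure_mono) (auto simp: not_less le_less)
  also have "\<dots> = weight (I \<inter> {..<m}) + 1 / 4 ^ Suc m"
    by (subst measure_pmf.finite_measure_Union) (auto simp: weight_greaterThan)
  also have "\<dots> + 2 / 4 ^ Suc m = weight (I \<inter> {..<m}) + weight {m}"
    by (simp add: weight_singleton field_simps)
  also have "\<dots> = weight (I \<inter> {..<m} \<union> {m})"
    by (subst measure_pmf.finite_measure_Union) auto
  also have "\<dots> \<le> weight I"
    using assms(1) by (intro measure_pmf.finite_measure_mono) auto
  finally show ?thesis by simp
qed

text \<open>
  The sets \<open>I'\<close> and \<open>J'\<close> agree with \<open>I\<close> and \<open>J\<close> up to \<open>n\<close> but are unconstrained beyond; the bound on \<open>\<eta>\<close> is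
  the gap left by a first difference at \<open>n\<close>, the smallest that can occur.
\<close>

lemma same_initial_digits:
  assumes IJ: "weight I \<le> weight J' + \<eta>" and JI: "weight J \<le> weight I' + \<eta>"
    and "\<And>i. i \<le> n \<Longrightarrow> i \<in> I' \<longleftrightarrow> i \<in> I" "\<And>i. i \<le> n \<Longrightarrow> i \<in> J' \<longleftrightarrow> i \<in> J"
    and \<eta>: "\<eta> < 2 / 4 ^ Suc n" and "i \<le> n"
  shows "i \<in> I \<longleftrightarrow> i \<in> J"
proof (rule ccontr)
  assume neq: "(i \<in> I) \<noteq> (i \<in> J)"
  define m where "m = (LEAST i. (i \<in> I) \<noteq> (i \<in> J))"
  have m: "(m \<in> I) \<noteq> (m \<in> J)" and "m \<le> i"
    unfolding m_def using neq by (fact LeastI, fact Least_le)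
  have less: "j \<in> I \<longleftrightarrow> j \<in> J" if "j < m" for j
    using not_less_Least[of j "\<lambda>i. (i \<in> I) \<noteq> (i \<in> J)"] that by (auto simp: m_def)
  have "m \<le> n"
    using \<open>m \<le> i\<close> \<open>i \<le> n\<close> by simp
  then have "2 / 4 ^ Suc n \<le> (2 / 4 ^ Suc m :: real)"
    by (intro divide_left_mono power_increasing) auto
  moreover have "2 / 4 ^ Suc m \<le> \<eta>"
  proof (cases "m \<in> I")
    case True
    then have "weight J' + 2 / 4 ^ Suc m \<le> weight I"
      using m less \<open>m \<le> n\<close> assms(4) by (intro weight_diff_first_difference) auto
    with IJ show ?thesis by simp
  next
    case False
    then have "weight I' + 2 / 4 ^ Suc m \<le> weight J"
      using m less \<open>m \<le> n\<close> assms(3) by (intro weight_diff_first_difference) auto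
    with JI show ?thesis by simp
  qed
  ultimately show False
    using \<eta> by simp
qed

lemma atomic_measurable:
  assumes "\<And>i. x i \<in> X"
  shows "x \<in> measurable (measure_pmf p) (restrict_space borel X)"
  using assms by (simp add: space_restrict_space)

lemma atomic_measure_in_wasserstein_space:
  assumes "\<And>i. x i \<in> X"
  shows "atomic_measure X x \<in> wasserstein_space X"
  unfolding wasserstein_space_def atomic_measure_def
  using measure_pmf.prob_space_distr[OF atomic_measurable[of x X, OF assms]] by simp

lemma measure_atomic_measure:
  assumes "\<And>i. x i \<in> X" "S \<in> sets (restrict_space borel X)"
  shows "measure (atomic_measure X x) S = weight {i. x i \<in> S}"
  unfolding atomic_measure_def
  using assms(2) by (subst measure_distr[OF atomic_measurable[of x X, OF assms(1)]]) (auto simp: vimage_def)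

text \<open>
  As \<open>X\<close> is bounded, the product coupling has finite cost. So the infimum in the definition of the
  distance is finite, and its conversion to a real number loses nothing.
\<close>

lemma W2_less_imp_coupling:
  fixes X :: "'a::metric_space set"
  assumes "compact X" "\<mu> \<in> wasserstein_space X" "\<nu> \<in> wasserstein_space X" and less: "W2 \<mu> \<nu> < r"
  obtains P where "P \<in> couplings \<mu> \<nu>" "(\<integral>\<^sup>+ p. ennreal ((dist (fst p) (snd p))\<^sup>2) \<partial>P) < ennreal (r\<^sup>2)"
proof -
  define I where "I = (INF P\<in>couplings \<mu> \<nu>. \<integral>\<^sup>+ p. ennreal ((dist (fst p) (snd p))\<^sup>2) \<partial>P)"
  have sets[simp]: "sets \<mu> = sets (restrict_space borel X)" "sets \<nu> = sets (restrict_space borel X)"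
    and "prob_space \<mu>" "prob_space \<nu>"
    using assms by (auto simp: wasserstein_space_def)
  have space: "space \<mu> = X" "space \<nu> = X"
    using sets[THEN sets_eq_imp_space_eq] by (auto simp: space_restrict_space)
  interpret \<mu>: prob_space \<mu> by fact
  interpret \<nu>: prob_space \<nu> by fact
  interpret pair_prob_space \<mu> \<nu> ..
  have coupling: "\<mu> \<Otimes>\<^sub>M \<nu> \<in> couplings \<mu> \<nu>"
  proof -
    have "distr (\<mu> \<Otimes>\<^sub>M \<nu>) \<mu> fst = \<mu>"
      by (rule \<nu>.distr_pair_fst)
    moreover have "distr (\<mu> \<Otimes>\<^sub>M \<nu>) \<nu> snd = \<nu>"
    proof (rule measure_eqI)
      fix A assume "A \<in> sets (distr (\<mu> \<Otimes>\<^sub>M \<nu>) \<nu> snd)"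
      then have A: "A \<in> sets \<nu>" by (simp only: sets_distr)
      then have "emeasure (distr (\<mu> \<Otimes>\<^sub>M \<nu>) \<nu> snd) A = emeasure (\<mu> \<Otimes>\<^sub>M \<nu>) (space \<mu> \<times> A)"
        using sets.sets_into_space[OF A]
        by (subst emeasure_distr) (auto simp: space_pair_measure intro!: arg_cong[where f = "emeasure _"])
      with A show "emeasure (distr (\<mu> \<Otimes>\<^sub>M \<nu>) \<nu> snd) A = emeasure \<nu> A"
        by (simp only: \<nu>.emeasure_pair_measure_Times sets.top \<mu>.emeasure_space_1) simp
    qed simp
    ultimately show ?thesis
      unfolding couplings_def using prob_space_axioms by blast
  qed
  obtain B where B: "\<And>x y. x \<in> X \<Longrightarrow> y \<in> X \<Longrightarrow> dist x y \<le> B"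
    using compact_imp_bounded[OF \<open>compact X\<close>, unfolded bounded_two_points] by blast
  have "I \<le> (\<integral>\<^sup>+ p. ennreal ((dist (fst p) (snd p))\<^sup>2) \<partial>(\<mu> \<Otimes>\<^sub>M \<nu>))"
    unfolding I_def using coupling by (rule INF_lower)
  also have "\<dots> \<le> (\<integral>\<^sup>+ p. ennreal (B\<^sup>2) \<partial>(\<mu> \<Otimes>\<^sub>M \<nu>))"
    using B by (intro nn_integral_mono) (auto simp: space_pair_measure space intro!: power_mono)
  also have "\<dots> < \<top>"
    using emeasure_space_1 by (simp add: ennreal_mult_less_top)
  finally have "I \<noteq> \<top>" by simp
  have "sqrt (enn2real I) < r"
    using less by (simp add: W2_def I_def)
  then have "(sqrt (enn2real I))\<^sup>2 < r\<^sup>2"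
    by (intro power_strict_mono) auto
  then have "enn2real I < r\<^sup>2"
    by simp
  then have "I < ennreal (r\<^sup>2)"
    using \<open>I \<noteq> \<top>\<close> by (cases I) (auto simp: ennreal_less_iff)
  then show thesis
    using that unfolding I_def INF_less_iff by blast
qed

text \<open>
  Mass in \<open>S\<close> that is not transported into \<open>T\<close> travels at least \<open>\<rho>\<close> and pays at least \<open>\<rho>\<^sup>2\<close> per unit. Applying
  Markov's inequality to the rectangle \<open>S \<times> (X - T)\<close> instead of a level set of the distance makes its
  measurability for the product \<open>\<sigma>\<close>-algebra evident.
\<close>

lemma W2_measure_mono:
  fixes X :: "'a::metric_space set"
  assumes "compact X" "\<mu> \<in> wasserstein_space X" "\<nu> \<in> wasserstein_space X" and less: "W2 \<mu> \<nu> < r"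
    and S: "S \<in> sets (restrict_space borel X)" and T: "T \<in> sets (restrict_space borel X)"
    and far: "\<And>x y. \<lbrakk>x \<in> S; y \<in> X; y \<notin> T\<rbrakk> \<Longrightarrow> \<rho> \<le> dist x y" and "0 < \<rho>"
  shows "measure \<mu> S \<le> measure \<nu> T + (r / \<rho>)\<^sup>2"
proof -
  from assms(1-4) obtain P where P: "P \<in> couplings \<mu> \<nu>"
    and cost: "(\<integral>\<^sup>+ p. ennreal ((dist (fst p) (snd p))\<^sup>2) \<partial>P) < ennreal (r\<^sup>2)"
    by (rule W2_less_imp_coupling)
  have sets: "sets \<mu> = sets (restrict_space borel X)" "sets \<nu> = sets (restrict_space borel X)"
    using assms(2,3) by (auto simp: wasserstein_space_def)
  have space: "space \<mu> = X" "space \<nu> = X"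
    using sets[THEN sets_eq_imp_space_eq] by (auto simp: space_restrict_space)
  have setsP[measurable_cong]: "sets P = sets (\<mu> \<Otimes>\<^sub>M \<nu>)" and "prob_space P"
    and fst: "distr P \<mu> fst = \<mu>" and snd: "distr P \<nu> snd = \<nu>"
    using P by (auto simp: couplings_def)
  interpret prob_space P by fact
  have spaceP: "space P = X \<times> X"
    using setsP[THEN sets_eq_imp_space_eq] by (simp add: space_pair_measure space)
  have SX: "S \<subseteq> X" "S \<in> sets \<mu>" and TX: "T \<subseteq> X" "T \<in> sets \<nu>"
    using S T sets.sets_into_space[OF S] sets.sets_into_space[OF T] sets
    by (auto simp: space_restrict_space)
  have [measurable]: "X - T \<in> sets \<nu>"
    using TX(2) space by (metis sets.compl_sets)
  have M: "S \<times> (X - T) \<in> sets P"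
    unfolding setsP using SX by simp
  have R: "X \<times> T \<in> sets P"
    unfolding setsP using TX space by (metis pair_measureI sets.top)
  have "measure \<mu> S = measure (distr P \<mu> fst) S"
    by (simp add: fst)
  also have "\<dots> = prob (S \<times> X)"
    using SX by (subst measure_distr) (auto simp: spaceP intro!: arg_cong[where f = prob])
  also have "\<dots> \<le> prob ((X \<times> T) \<union> S \<times> (X - T))"
    using SX M R by (intro finite_measure_mono) auto
  also have "\<dots> \<le> prob (X \<times> T) + prob (S \<times> (X - T))"
    using R M by (rule measure_Un_le)
  also have "prob (X \<times> T) = measure (distr P \<nu> snd) T"
    using TX by (subst measure_distr) (auto simp: spaceP intro!: arg_cong[where f = prob])
  also have "\<dots> = measure \<nu> T"
    by (simp add: snd)
  also have "prob (S \<times> (X - T)) \<le> (r / \<rho>)\<^sup>2"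
  proof -
    have "ennreal (\<rho>\<^sup>2 * prob (S \<times> (X - T))) = (\<integral>\<^sup>+ p. ennreal (\<rho>\<^sup>2) * indicator (S \<times> (X - T)) p \<partial>P)"
      using M by (simp add: nn_integral_cmult_indicator emeasure_eq_measure ennreal_mult)
    also have "\<dots> \<le> (\<integral>\<^sup>+ p. ennreal ((dist (fst p) (snd p))\<^sup>2) \<partial>P)"
      using far \<open>0 < \<rho>\<close> by (intro nn_integral_mono) (auto simp: indicator_def intro!: ennreal_leI power_mono)
    also have "\<dots> \<le> ennreal (r\<^sup>2)"
      using cost by simp
    finally have "\<rho>\<^sup>2 * prob (S \<times> (X - T)) \<le> r\<^sup>2"
      by (simp add: ennreal_le_iff)
    then show ?thesis
      using \<open>0 < \<rho>\<close> by (simp add: power_divide pos_le_divide_eq mult.commute)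
  qed
  finally show ?thesis by simp
qed

lemma bounded_mono_stationary:
  fixes f :: "nat \<Rightarrow> nat"
  assumes "mono f" "\<And>k. f k \<le> N"
  shows "\<exists>k\<le>N. f (Suc k) = f k"
proof (rule ccontr)
  assume no: "\<not> (\<exists>k\<le>N. f (Suc k) = f k)"
  have "k \<le> f k" if "k \<le> Suc N" for k
    using that
  proof (induction k)
    case (Suc k)
    then have "f k \<le> f (Suc k)" "f (Suc k) \<noteq> f k"
      using no monoD[OF \<open>mono f\<close>, of k "Suc k"] by auto
    with Suc show ?case by simp
  qed simp
  from this[of "Suc N"] assms(2)[of "Suc N"] show False
    by simp
qed

text \<open>
  The mass of \<open>x n\<close> need not be sent to \<open>y n\<close>, since several atoms can be permuted; but it stays in a
  cluster. Consider the balls \<open>B k\<close> around \<open>x n\<close> of radius \<open>k \<rho>\<close> and the indices of the atoms in them. Up to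
  \<open>n\<close> there are only \<open>2 n + 2\<close> atoms, so for some \<open>k \<le> 2 n + 2\<close> no new one appears between \<open>B k\<close> and \<open>B (k + 1)\<close>.
  Then both measures give nearly the same mass to \<open>B k\<close>, which forces the index sets to agree up to
  \<open>n\<close>; as \<open>x n\<close> is in the ball, so is \<open>y n\<close>. The value of \<open>\<rho>\<close> makes \<open>(r / \<rho>)\<^sup>2\<close>, the mass that can travel \<open>\<rho>\<close>,
  a third of the weight of the \<open>n\<close>-th atom.
\<close>

lemma W2_atomic_measure_dist_le:
  fixes X :: "'a::metric_space set"
  assumes "compact X" and x: "\<And>i. x i \<in> X" and y: "\<And>i. y i \<in> X"
    and xy: "W2 (atomic_measure X x) (atomic_measure X y) < r"
    and yx: "W2 (atomic_measure X y) (atomic_measure X x) < r"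
  shows "dist (x n) (y n) \<le> (2 * real n + 2) * 2 ^ Suc n * r"
proof -
  have "r > 0"
    using xy by (rule le_less_trans[rotated]) (simp add: W2_def)
  define \<rho> where "\<rho> = 2 ^ Suc n * r"
  have "\<rho> > 0"
    using \<open>r > 0\<close> by (simp add: \<rho>_def)
  have "(r / \<rho>)\<^sup>2 = 1 / 4 ^ Suc n"
    using \<open>r > 0\<close> by (simp add: \<rho>_def power_divide power2_eq_square power_mult_distrib[symmetric])
  then have \<eta>: "(r / \<rho>)\<^sup>2 < 2 / 4 ^ Suc n"
    by (simp only:) (intro divide_strict_right_mono, auto)
  define B where "B k = cball (x n) (real k * \<rho>) \<inter> X" for k :: nat
  have B: "B k \<in> sets (restrict_space borel X)" for k
    by (auto simp: B_def sets_restrict_space)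
  have far: "\<rho> \<le> dist a b" if "a \<in> B k" "b \<in> X" "b \<notin> B (Suc k)" for a b k
    using that dist_triangle[of "x n" b a] by (auto simp: B_def algebra_simps)
  define I where "I k = {i. x i \<in> B k}" for k
  define J where "J k = {i. y i \<in> B k}" for k
  have IJ: "weight (I k) \<le> weight (J (Suc k)) + (r / \<rho>)\<^sup>2" for k
    using W2_measure_mono[OF \<open>compact X\<close> atomic_measure_in_wasserstein_space[OF x]
        atomic_measure_in_wasserstein_space[OF y] xy B[of k] B[of "Suc k"] far \<open>\<rho> > 0\<close>]
    by (simp add: measure_atomic_measure x y B I_def J_def)
  have JI: "weight (J k) \<le> weight (I (Suc k)) + (r / \<rho>)\<^sup>2" for k
    using W2_measure_mono[OF \<open>compact X\<close> atomic_measure_in_wasserstein_space[OF y]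
        atomic_measure_in_wasserstein_space[OF x] yx B[of k] B[of "Suc k"] far \<open>\<rho> > 0\<close>]
    by (simp add: measure_atomic_measure x y B I_def J_def)
  have mono: "B k \<subseteq> B l" if "k \<le> l" for k l
    using that \<open>\<rho> > 0\<close> unfolding B_def
    by (intro Int_mono subset_refl subset_cball mult_right_mono) auto
  define f where "f k = card (I k \<inter> {..n}) + card (J k \<inter> {..n})" for k
  have "mono f"
    unfolding f_def using mono
    by (intro monoI add_mono card_mono) (auto simp: I_def J_def)
  moreover have "f k \<le> 2 * n + 2" for k
    using card_mono[of "{..n}" "I k \<inter> {..n}"] card_mono[of "{..n}" "J k \<inter> {..n}"]
    by (simp add: f_def)
  ultimately obtain k where k: "k \<le> 2 * n + 2" "f (Suc k) = f k"
    using bounded_mono_stationary by blast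
  have sub: "I k \<inter> {..n} \<subseteq> I (Suc k) \<inter> {..n}" "J k \<inter> {..n} \<subseteq> J (Suc k) \<inter> {..n}"
    using mono[of k "Suc k"] by (auto simp: I_def J_def)
  from card_mono[OF _ sub(1)] card_mono[OF _ sub(2)] k(2)
  have "card (I k \<inter> {..n}) = card (I (Suc k) \<inter> {..n})" "card (J k \<inter> {..n}) = card (J (Suc k) \<inter> {..n})"
    by (auto simp: f_def)
  with sub have "I k \<inter> {..n} = I (Suc k) \<inter> {..n}" "J k \<inter> {..n} = J (Suc k) \<inter> {..n}"
    by (simp_all add: card_subset_eq)
  then have "i \<in> I (Suc k) \<longleftrightarrow> i \<in> I k" "i \<in> J (Suc k) \<longleftrightarrow> i \<in> J k" if "i \<le> n" for i
    using that by blast+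
  from same_initial_digits[OF IJ JI this \<eta>, of n] have "n \<in> I k \<longleftrightarrow> n \<in> J k"
    by simp
  moreover have "n \<in> I k"
    using x \<open>\<rho> > 0\<close> by (simp add: I_def B_def)
  ultimately have "dist (x n) (y n) \<le> real k * \<rho>"
    by (simp add: J_def B_def)
  also have "\<dots> \<le> (2 * real n + 2) * \<rho>"
    using k(1) \<open>\<rho> > 0\<close> by (intro mult_right_mono) auto
  finally show ?thesis
    by (simp add: \<rho>_def mult.assoc)
qed

text \<open>
  The weights cost a factor \<open>2^n\<close> and the chain of balls a linear factor; together
  they stay below a multiple of \<open>3^n\<close>, and the base 3 is where the constant
  \<open>ln 3\<close> comes from.
\<close>

lemma digit_loss_le: "(2 * real n + 2) * 2 ^ Suc n \<le> 3 ^ (n + 2)"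
proof (induction n)
  case (Suc n)
  show ?case
  \<comment> \<open>The left-hand side grows by a factor of at most 3 only from \<open>n = 1\<close> on.\<close>
  proof (cases "n = 0")
    case False
    then have "2 * (2 * real (Suc n) + 2) \<le> 3 * (2 * real n + 2)"
      by simp
    then have "(2 * real (Suc n) + 2) * 2 ^ Suc (Suc n) \<le> 3 * (2 * real n + 2) * 2 ^ Suc n"
      unfolding power_Suc[of _ "Suc n"] mult.assoc[symmetric]
      by (intro mult_right_mono) (auto simp: algebra_simps)
    also have "\<dots> \<le> 3 * 3 ^ (n + 2)"
      using mult_left_mono[OF Suc, of 3] by (simp only: mult.assoc)
    finally show ?thesis by simp
  qed simp
qed simp

section \<open>Gauges and critical parameters\<close>

lemma fine_gauge_mono:
  assumes "0 \<le> s" "0 < a" "a \<le> d" "d \<le> 1"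
  shows "fine_gauge s a \<le> fine_gauge s d"
proof -
  have "0 \<le> ln (1 / d)" "ln (1 / d) \<le> ln (1 / a)"
    using assms by (simp_all add: ln_div)
  then have "(ln (1 / d))\<^sup>2 \<le> (ln (1 / a))\<^sup>2"
    by (intro power_mono)
  then show ?thesis
    using assms by (simp add: fine_gauge_def mult_left_mono)
qed

lemma fine_gauge_inverse_power3: "fine_gauge s (1 / 3 ^ m) = exp (- (s * (real m * ln 3)\<^sup>2))"
  by (simp add: fine_gauge_def ln_realpow)

lemma fine_gauge_tendsto_0:
  assumes "0 < s"
  shows "(\<lambda>n. fine_gauge s (1 / 3 ^ (n + 3))) \<longlonglongrightarrow> 0"
proof (rule tendsto_sandwich[OF _ _ tendsto_const])
  define q where "q = exp (- (s * (ln 3)\<^sup>2))"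
  have "0 < q" "q < 1"
    using assms by (auto simp: q_def)
  then show "(\<lambda>n. q ^ n) \<longlonglongrightarrow> 0"
    by (intro LIMSEQ_realpow_zero) auto
  show "\<forall>\<^sub>F n in sequentially. fine_gauge s (1 / 3 ^ (n + 3)) \<le> q ^ n"
  proof (intro always_eventually allI)
    fix n
    have "real n \<le> (real (n + 3))\<^sup>2"
      by (simp add: power2_eq_square algebra_simps)
    then have "s * (ln 3)\<^sup>2 * real n \<le> s * (ln 3)\<^sup>2 * (real (n + 3))\<^sup>2"
      using assms by (intro mult_left_mono) auto
    then show "fine_gauge s (1 / 3 ^ (n + 3)) \<le> q ^ n"
      unfolding fine_gauge_inverse_power3 q_def exp_of_nat_mult[symmetric]
      by (simp add: power_mult_distrib mult_ac)
  qed
  show "\<forall>\<^sub>F n in sequentially. 0 \<le> fine_gauge s (1 / 3 ^ (n + 3))"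
    by (simp add: fine_gauge_inverse_power3)
qed

lemma prod_cost_eq_exp:
  assumes "0 < w"
  shows "(\<Prod>i=1..n. (3 powr - t) ^ i / w) = exp (- (t * ln 3 * (real n * (real n + 1) / 2)) - real n * ln w)"
proof (induction n)
  case (Suc n)
  have "(3 powr - t) ^ Suc n / w = exp (- (t * ln 3 * real (Suc n)) - ln w)"
    using assms by (simp add: powr_def exp_diff exp_of_nat_mult[symmetric] mult_ac del: power_Suc of_nat_Suc)
  with Suc show ?case
    by (simp add: exp_add[symmetric] algebra_simps add_divide_distrib)
qed simp

text \<open>
  After taking logarithms the coefficient of \<open>n\<^sup>2\<close> in the difference is \<open>\<alpha> > 0\<close>; the constant \<open>w\<close> and the
  shift by 3 only affect the linear term and the constant.
\<close>

lemma prod_cost_le_fine_gauge: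
  assumes "0 < w" and "2 * s * ln 3 < t"
  shows "\<exists>N. \<forall>n\<ge>N. (\<Prod>i=1..n. (3 powr - t) ^ i / w) \<le> fine_gauge s (1 / 3 ^ (n + 3))"
proof -
  define L where "L = ln (3::real)"
  have "L > 0"
    by (simp add: L_def)
  define \<alpha> where "\<alpha> = (t / 2 - s * L) * L"
  have "\<alpha> > 0"
    using assms(2) \<open>L > 0\<close> by (simp add: \<alpha>_def L_def)
  define \<beta> where "\<beta> = t * L / 2 + ln w - 6 * s * L\<^sup>2"
  define \<gamma> where "\<gamma> = \<bar>9 * s * L\<^sup>2\<bar>"
  obtain N where N: "(\<bar>\<beta>\<bar> + \<gamma>) / \<alpha> < real N"
    using reals_Archimedean2 by blast
  have "(\<Prod>i=1..n. (3 powr - t) ^ i / w) \<le> fine_gauge s (1 / 3 ^ (n + 3))" if "N \<le> n" for n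
  proof -
    have "(\<bar>\<beta>\<bar> + \<gamma>) / \<alpha> < real n"
      using N \<open>N \<le> n\<close> by linarith
    then have n: "\<bar>\<beta>\<bar> + \<gamma> < \<alpha> * real n"
      using \<open>\<alpha> > 0\<close> by (simp add: pos_divide_less_eq mult.commute)
    then have "0 < \<alpha> * real n"
      by (rule le_less_trans[rotated]) (simp add: \<gamma>_def)
    then have "1 \<le> real n"
      using \<open>\<alpha> > 0\<close> by (cases n) auto
    have "\<bar>\<beta>\<bar> * real n + \<gamma> * 1 \<le> \<bar>\<beta>\<bar> * real n + \<gamma> * real n"
      using \<open>1 \<le> real n\<close> by (intro add_mono mult_left_mono) (auto simp: \<gamma>_def)
    also have "\<dots> \<le> (\<alpha> * real n) * real n"
      using mult_right_mono[OF less_imp_le[OF n], of "real n"] by (simp add: distrib_right)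
    finally have "0 \<le> \<alpha> * real n * real n - \<bar>\<beta>\<bar> * real n - \<gamma>"
      by simp
    also have "\<dots> \<le> \<alpha> * real n * real n + \<beta> * real n - 9 * s * L\<^sup>2"
    proof -
      have "- \<bar>\<beta>\<bar> * real n \<le> \<beta> * real n"
        by (intro mult_right_mono) auto
      moreover have "9 * s * L\<^sup>2 \<le> \<gamma>"
        by (simp add: \<gamma>_def)
      ultimately show ?thesis by simp
    qed
    also have "\<dots> = t * L * (real n * (real n + 1) / 2) + real n * ln w - s * (real (n + 3) * L)\<^sup>2"
      by (simp add: \<alpha>_def \<beta>_def power2_eq_square field_simps)
    finally show ?thesis
      unfolding prod_cost_eq_exp[OF assms(1)] fine_gauge_inverse_power3 L_def[symmetric] by simp
  qed
  then show ?thesis by blast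
qed

lemma inverse_power3_bracket:
  assumes "0 < (d::real)" "d \<le> 1 / 3 ^ (N + 3)"
  obtains n where "N \<le> n" "1 / 3 ^ (n + 3) \<le> d" "d < 1 / 3 ^ (n + 2)"
proof -
  have "(\<lambda>n. (1/3::real) ^ n) \<longlonglongrightarrow> 0"
    by (intro LIMSEQ_realpow_zero) auto
  then have "\<forall>\<^sub>F n in sequentially. (1/3::real) ^ n < d"
    using \<open>0 < d\<close> by (intro order_tendstoD)
  then obtain m0 where m0: "1 / 3 ^ m0 \<le> d"
    unfolding eventually_sequentially power_one_over by (meson less_imp_le order_refl)
  define m where "m = (LEAST m. 1 / 3 ^ m \<le> d)"
  have m: "1 / 3 ^ m \<le> d"
    unfolding m_def using m0 by (rule LeastI)
  have "N + 3 \<le> m"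
  proof (rule ccontr)
    assume "\<not> N + 3 \<le> m"
    then have "1 / 3 ^ (N + 3) < (1 / 3 ^ m :: real)"
      by (intro divide_strict_left_mono power_strict_increasing) auto
    with m assms(2) show False by simp
  qed
  moreover have "\<not> 1 / 3 ^ (m - 1) \<le> d"
    using not_less_Least[of "m - 1" "\<lambda>m. 1 / 3 ^ m \<le> d"] \<open>N + 3 \<le> m\<close> by (simp add: m_def)
  moreover from \<open>N + 3 \<le> m\<close> obtain n where "m = n + 3"
    by (metis le_add_diff_inverse2 add_leD2)
  ultimately show thesis
    using m by (intro that[of n]) (auto simp: not_le)
qed

text \<open>
  The sequences whose measure lies in the set \<open>E j\<close> of a cover lie in a box with \<open>n j\<close> sides,
  where \<open>3^(-n j)\<close> is comparable to the diameter; a fine mesh makes \<open>n j\<close> so large that the cost of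
  the box is at most the gauge of the diameter. A set of diameter 0 has
  gauge 0 and admits any \<open>n j\<close>, so a summable error \<open>2^(-j-2)\<close> is conceded, which adds up to \<open>1/2\<close>.
\<close>

lemma fine_measure_wasserstein_pos:
  fixes X :: "'a::metric_space set"
  assumes "compact X" and pos: "gen_hausdorff_measure (\<lambda>r. r powr s') X dist X > 0"
    and "0 < s" "2 * s * ln 3 < t" "t < s'"
  shows "gen_hausdorff_measure (fine_gauge s) (wasserstein_space X) W2 (wasserstein_space X) > 0"
proof -
  have "0 < 2 * s * ln 3"
    using \<open>0 < s\<close> by (intro mult_pos_pos) auto
  with \<open>2 * s * ln 3 < t\<close> have "0 < t"
    by linarith
  obtain w where "0 < w" and w: "weighted_cover_cost_ge X (3 powr - t) w"
    using weighted_cover_cost_bounded_below[OF pos \<open>0 < t\<close> \<open>t < s'\<close>] by blast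
  define D where "D n = (\<Prod>i=1..n. (3 powr - t) ^ i / w)" for n
  obtain N where N: "\<And>n. N \<le> n \<Longrightarrow> D n \<le> fine_gauge s (1 / 3 ^ (n + 3))"
    using prod_cost_le_fine_gauge[OF \<open>0 < w\<close> \<open>2 * s * ln 3 < t\<close>] unfolding D_def by blast
  have "ennreal (1/2) \<le> (\<Sum>j. ennreal (fine_gauge s (enn2real (mdiam W2 (E j)))))"
    if E: "E \<in> closed_covers (wasserstein_space X) W2 (wasserstein_space X) (1 / 3 ^ (N + 3))" for E
  proof -
    define d where "d j = enn2real (mdiam W2 (E j))" for j
    have le: "mdiam W2 (E j) \<le> ennreal (1 / 3 ^ (N + 3))" for j
      using E by (auto simp: closed_covers_def)
    have d: "mdiam W2 (E j) = ennreal (d j)" "0 \<le> d j" "d j \<le> 1 / 3 ^ (N + 3)" for j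
      using le[of j] by (auto simp: d_def enn2real_leI le_less_trans[OF _ ennreal_less_top])
    have "\<exists>n. d j < 1 / 3 ^ (n + 2) \<and> D n \<le> fine_gauge s (d j) + (1/2) ^ (j + 2)" for j
    proof (cases "d j = 0")
      case True
      have "\<forall>\<^sub>F n in sequentially. fine_gauge s (1 / 3 ^ (n + 3)) < (1/2) ^ (j + 2)"
        using fine_gauge_tendsto_0[OF \<open>0 < s\<close>] by (intro order_tendstoD) auto
      then obtain n0 where "\<And>n. n0 \<le> n \<Longrightarrow> fine_gauge s (1 / 3 ^ (n + 3)) < (1/2) ^ (j + 2)"
        unfolding eventually_sequentially by blast
      then have "D (max N n0) \<le> (1/2) ^ (j + 2)"
        using N[of "max N n0"] by (meson less_imp_le max.cobounded1 max.cobounded2 order_trans)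
      then show ?thesis
        using True by (intro exI[of _ "max N n0"]) (simp add: fine_gauge_def)
    next
      case False
      with d(2)[of j] have "0 < d j" by simp
      then obtain n where n: "N \<le> n" "1 / 3 ^ (n + 3) \<le> d j" "d j < 1 / 3 ^ (n + 2)"
        using d(3) by (rule inverse_power3_bracket)
      have "(1::real) \<le> 3 ^ (n + 2)"
        by (rule one_le_power) simp
      then have "(1 / 3 ^ (n + 2) :: real) \<le> 1"
        by (simp only: divide_le_eq_1) simp
      with less_imp_le[OF n(3)] have "d j \<le> 1"
        by (rule order_trans)
      have "D n \<le> fine_gauge s (1 / 3 ^ (n + 3))"
        using N n(1) .
      also have "\<dots> \<le> fine_gauge s (d j)"
        using \<open>0 < s\<close> n(2) \<open>d j \<le> 1\<close> by (intro fine_gauge_mono) auto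
      also have "\<dots> \<le> fine_gauge s (d j) + (1/2) ^ (j + 2)"
        by simp
      finally show ?thesis
        using n(3) by blast
    qed
    then obtain n where n: "\<And>j. d j < 1 / 3 ^ (n j + 2)"
        "\<And>j. D (n j) \<le> fine_gauge s (d j) + (1/2) ^ (j + 2)"
      by metis
    define A where "A j i = {x i |x. (\<forall>i. x i \<in> X) \<and> atomic_measure X x \<in> E j}" for j i
    have diam: "dist a a' \<le> 1 / 3 ^ (n j - i)" if "i < n j" and a: "a \<in> A j i" and a': "a' \<in> A j i" for a a' i j
    proof -
      obtain x where x: "\<And>i. x i \<in> X" "atomic_measure X x \<in> E j" "a = x i"
        using a by (auto simp: A_def)
      obtain y where y: "\<And>i. y i \<in> X" "atomic_measure X y \<in> E j" "a' = y i"
        using a' by (auto simp: A_def)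
      have "W2 \<mu> \<nu> < 1 / 3 ^ (n j + 2)" if "\<mu> \<in> E j" "\<nu> \<in> E j" for \<mu> \<nu>
      proof -
        have "W2 \<mu> \<nu> \<le> d j"
          using d(1,2)[of j] that mdiam_le_iff[of "d j" W2 "E j"] by auto
        with n(1) show ?thesis by (rule le_less_trans[rotated])
      qed
      with x y have "dist a a' \<le> (2 * real i + 2) * 2 ^ Suc i * (1 / 3 ^ (n j + 2))"
        using W2_atomic_measure_dist_le[OF \<open>compact X\<close>, of x y "1 / 3 ^ (n j + 2)" i] by simp
      also have "\<dots> \<le> 3 ^ (i + 2) * (1 / 3 ^ (n j + 2))"
        by (intro mult_right_mono digit_loss_le) auto
      also have "\<dots> = 1 / 3 ^ (n j - i)"
        using \<open>i < n j\<close> by (simp add: power_add power_diff)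
      finally show ?thesis .
    qed
    have "1 \<le> (\<Sum>j. ennreal (D (n j)))"
    proof (rule ccontr)
      assume "\<not> 1 \<le> (\<Sum>j. ennreal (D (n j)))"
      then have small: "(\<Sum>j. ennreal (\<Prod>i=1..n j. (3 powr - t) ^ i / w)) < 1"
        by (simp add: D_def not_le)
      obtain x where x: "\<And>i. x i \<in> X" "\<And>j. \<exists>i<n j. x i \<notin> A j i"
        by (rule greedy_uncovered_sequence[OF \<open>0 < w\<close> _ w diam small]) auto
      obtain j where "atomic_measure X x \<in> E j"
        using atomic_measure_in_wasserstein_space[of x X] x(1) E by (auto simp: closed_covers_def)
      then have "x i \<in> A j i" for i
        using x(1) by (auto simp: A_def)
      with x(2) show False by blast
    qed
    also have "\<dots> \<le> (\<Sum>j. ennreal (fine_gauge s (d j)) + ennreal ((1/2) ^ (j + 2)))"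
    proof (intro suminf_le)
      show "ennreal (D (n j)) \<le> ennreal (fine_gauge s (d j)) + ennreal ((1/2) ^ (j + 2))" for j
        using ennreal_leI[OF n(2)[of j]] by (subst ennreal_plus[symmetric]) (auto simp: fine_gauge_def)
    qed auto
    also have "\<dots> = (\<Sum>j. ennreal (fine_gauge s (d j))) + (\<Sum>j. ennreal ((1/2) ^ (j + 2)))"
      by (rule suminf_add[symmetric]) auto
    also have "(\<Sum>j. ennreal ((1/2) ^ (j + 2))) = ennreal (1/2)"
    proof (rule suminf_ennreal_eq)
      have "(\<lambda>j. (1/4) * (1/2::real) ^ j) sums ((1/4) * (1 / (1 - 1/2)))"
        by (intro sums_mult geometric_sums) auto
      then show "(\<lambda>j. (1/2::real) ^ (j + 2)) sums (1/2)"
        by (simp add: power_add power2_eq_square mult.commute)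
    qed auto
    finally have "1 \<le> (\<Sum>j. ennreal (fine_gauge s (d j))) + ennreal (1/2)" .
    also have "\<dots> = ennreal (1/2) + (\<Sum>j. ennreal (fine_gauge s (d j)))"
      by (rule add.commute)
    also have "1 = ennreal (1/2) + ennreal (1/2)"
      by (subst ennreal_plus[symmetric]) simp_all
    finally have "ennreal (1/2) \<le> (\<Sum>j. ennreal (fine_gauge s (d j)))"
      unfolding ennreal_add_left_cancel_le by simp
    then show ?thesis
      unfolding d_def .
  qed
  then show ?thesis
    unfolding gen_hausdorff_measure_pos_iff
    by (intro exI[of _ "1 / 3 ^ (N + 3)"] conjI exI[of _ "1/2"]) auto
qed

text \<open>
  With \<open>u = ln (1 / r)\<close> the claim is \<open>u powr s \<le> \<sigma> u^2\<close> for
  large \<open>u\<close>.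
\<close>

lemma fine_gauge_le_coarse_gauge:
  assumes "0 < \<sigma>" "s < 2"
  shows "\<exists>\<rho>>0. \<forall>r. 0 \<le> r \<longrightarrow> r \<le> \<rho> \<longrightarrow> fine_gauge \<sigma> r \<le> coarse_gauge s r"
proof -
  have "((\<lambda>u::real. u powr (s - 2)) \<longlongrightarrow> 0) at_top"
    using assms(2) by (intro tendsto_neg_powr filterlim_ident) auto
  then have "\<forall>\<^sub>F u in at_top. u powr (s - 2) < \<sigma>"
    using assms(1) by (intro order_tendstoD)
  then obtain U where U: "\<And>u. U \<le> u \<Longrightarrow> u powr (s - 2) < \<sigma>"
    unfolding eventually_at_top_linorder by blast
  have "fine_gauge \<sigma> r \<le> coarse_gauge s r" if "0 < r" "r \<le> exp (- max U 1)" for r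
  proof -
    define u where "u = ln (1 / r)"
    have "ln r \<le> - max U 1"
      using that by (metis ln_exp ln_mono exp_gt_zero)
    then have u: "U \<le> u" "1 \<le> u"
      using \<open>0 < r\<close> by (auto simp: u_def ln_div)
    have "u powr s = u powr (s - 2) * u\<^sup>2"
      using u(2) by (simp add: powr_diff)
    also have "\<dots> \<le> \<sigma> * u\<^sup>2"
      using U[OF u(1)] by (intro mult_right_mono) auto
    finally show ?thesis
      using \<open>0 < r\<close> by (simp add: fine_gauge_def coarse_gauge_def u_def)
  qed
  then have "fine_gauge \<sigma> r \<le> coarse_gauge s r" if "0 \<le> r" "r \<le> exp (- max U 1)" for r
    using that by (cases "r = 0") (auto simp: fine_gauge_def coarse_gauge_def)
  then show ?thesis
    by (intro exI[of _ "exp (- max U 1)"]) auto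
qed

lemma le_critI:
  assumes "s \<in> J" "gen_hausdorff_measure (F s) M d M > 0"
  shows "ereal s \<le> crit J F M d"
  using assms unfolding crit_def by (auto simp: Let_def intro!: Sup_upper)

lemma less_hausdorff_dimE:
  assumes "ereal z < hausdorff_dim M d" "0 \<le> z"
  obtains s where "z < s" "gen_hausdorff_measure (\<lambda>r. r powr s) M d M > 0"
proof -
  define S where "S = {s::real. s \<in> {0<..} \<and> gen_hausdorff_measure (\<lambda>r. r powr s) M d M > 0}"
  have dim: "hausdorff_dim M d = (if S = {} then Inf (ereal ` {0<..}) else Sup (ereal ` S))"
    unfolding hausdorff_dim_def crit_def S_def Let_def by (rule refl)
  have "\<not> ereal z < Inf (ereal ` {0<..})"
  proof
    assume "ereal z < Inf (ereal ` {0<..})"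
    then obtain r where r: "ereal z < ereal r" "ereal r < Inf (ereal ` {0<..})"
      using ereal_dense2 by blast
    then have "Inf (ereal ` {0<..}) \<le> ereal r"
      using \<open>0 \<le> z\<close> by (intro Inf_lower) auto
    with r show False by simp
  qed
  with assms(1) dim have "ereal z < Sup (ereal ` S)"
    by (auto split: if_splits)
  then show thesis
    using that by (auto simp: less_Sup_iff S_def)
qed

theorem proposition1p6:
  fixes X :: "'a::metric_space set"
  assumes "compact X"
    and "hausdorff_dim X dist > 0"
  shows "at_least_intermediate_size (wasserstein_space X) W2
    \<and> crit_coarse (wasserstein_space X) W2 \<ge> 2
    \<and> crit_fine (wasserstein_space X) W2 \<ge> hausdorff_dim X dist / ereal (2 * ln 3)"
proof (intro conjI)
  let ?W = "wasserstein_space X" and ?D = "hausdorff_dim X dist"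
  have ln3: "0 < 2 * ln (3::real)"
    by simp
  have fine: "gen_hausdorff_measure (fine_gauge s) ?W W2 ?W > 0"
    if "0 < s" and s: "ereal s < ?D / ereal (2 * ln 3)" for s
  proof -
    have "ereal (2 * s * ln 3) < ?D"
      using s ln3 by (simp add: ereal_less_divide_pos mult_ac)
    moreover have "0 \<le> 2 * s * ln 3"
      using \<open>0 < s\<close> by (intro mult_nonneg_nonneg) auto
    ultimately obtain s' where s': "2 * s * ln 3 < s'"
        "gen_hausdorff_measure (\<lambda>r. r powr s') X dist X > 0"
      by (rule less_hausdorff_dimE)
    from dense[OF s'(1)] obtain t where "2 * s * ln 3 < t" "t < s'"
      by blast
    with assms(1) s'(2) \<open>0 < s\<close> show ?thesis
      by (rule fine_measure_wasserstein_pos)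
  qed
  have pos: "0 < ?D / ereal (2 * ln 3)"
    using assms(2) ln3 by (simp add: ereal_less_divide_pos)
  show "?D / ereal (2 * ln 3) \<le> crit_fine ?W W2"
  proof (rule dense_le)
    fix x assume "x < ?D / ereal (2 * ln 3)"
    with pos have "max 0 x < ?D / ereal (2 * ln 3)"
      by simp
    then obtain s where s: "max 0 x < ereal s" "ereal s < ?D / ereal (2 * ln 3)"
      using ereal_dense2 by blast
    then have "ereal s \<le> crit_fine ?W W2"
      unfolding crit_fine_def using fine by (intro le_critI) auto
    with s(1) show "x \<le> crit_fine ?W W2"
      by (meson less_imp_le max.strict_boundedE order_trans)
  qed
  show two: "2 \<le> crit_coarse ?W W2"
  proof (rule dense_le)
    fix x :: ereal assume "x < 2"
    then have "max 1 x < ereal 2"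
      by simp
    then obtain s where s: "max 1 x < ereal s" "ereal s < ereal 2"
      using ereal_dense2 by blast
    obtain \<sigma> where \<sigma>: "0 < ereal \<sigma>" "ereal \<sigma> < ?D / ereal (2 * ln 3)"
      using ereal_dense2[OF pos] by blast
    obtain \<rho> where \<rho>: "0 < \<rho>" "\<And>r. 0 \<le> r \<Longrightarrow> r \<le> \<rho> \<Longrightarrow> fine_gauge \<sigma> r \<le> coarse_gauge s r"
      using fine_gauge_le_coarse_gauge[of \<sigma> s] \<sigma>(1) s(2) by auto
    have "gen_hausdorff_measure (fine_gauge \<sigma>) ?W W2 ?W > 0"
      using \<sigma> by (intro fine) simp_all
    then have "gen_hausdorff_measure (coarse_gauge s) ?W W2 ?W > 0"
      using \<rho> by (rule gen_hausdorff_measure_pos_mono)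
    then have "ereal s \<le> crit_coarse ?W W2"
      unfolding crit_coarse_def using s(1) by (intro le_critI) auto
    with s(1) show "x \<le> crit_coarse ?W W2"
      by (meson less_imp_le max.strict_boundedE order_trans)
  qed
  have "Inf (ereal ` {1..}) \<le> ereal 1"
    by (intro Inf_lower) auto
  also have "\<dots> < 2"
    by simp
  finally show "at_least_intermediate_size ?W W2"
    using two unfolding at_least_intermediate_size_def by auto
qed

end
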